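(* Let $\mathcal C\subseteq\mathbb N$ be a (possibly infinite) ruleset all of whose elements are odd, with $\min\mathcal C=1$. Then for every $n\ge1$, in the partition game with ruleset $\mathcal C$, $\mathcal G(n)=0$ if $n$ is odd and $\mathcal G(n)=1$ if $n$ is even.
   Context: $\mathbb N=\{1,2,\ldots\}$ and $\mathbb N_0=\mathbb N\cup\{0\}$. A ruleset is a set $\mathcal C\subseteq\mathbb N$ of allowed cut-numbers. In the partition game with ruleset $\mathcal C$, positions are finite collections (disjunctive sums) of heaps of positive integer sizes; a move chooses one heap, of size $n$, chooses $c\in\mathcal C$, and replaces that heap by $c+1$ heaps of positive integer sizes $n_0,\ldots,n_c$ with $n_0+\cdots+n_c=n$ (a $c$-cut). The Sprague-Grundy value of a single heap of size $n\ge1$ is defined recursively by $$\mathcal G(n)=\operatorname{mex}\{\mathcal G(n_0)\oplus\cdots\oplus\mathcal G(n_c)\mid c\in\mathcal C,\ n_i\in\mathbb N,\ n_0+\cdots+n_c=n\},$$ where $\oplus$ is nim-sum (bitwise XOR) and $\operatorname{mex}(U)=\min(\mathbb N_0\setminus U)$. *)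

theory Defs
  imports Main
begin

definition mex :: "nat set \<Rightarrow> nat" where
  "mex U = (LEAST k. k \<notin> U)"

definition nim_sum :: "nat list \<Rightarrow> nat" where
  "nim_sum xs = foldr xor xs 0"

text \<open>
  A \<open>c\<close>-cut of a heap of size \<open>n\<close> is encoded as the list \<open>[n\<^sub>0, \<dots>, n\<^sub>c]\<close>.
  Rulesets consist of positive cut-numbers, whereas \<open>nat\<close> contains \<open>0\<close>; the condition \<open>0 < c\<close>
  makes the recursion below well-founded for an arbitrary \<open>C :: nat set\<close> and is vacuous
  for rulesets.
\<close>

definition cuts :: "nat set \<Rightarrow> nat \<Rightarrow> nat list set" where
  "cuts C n = {ns. (\<exists>c\<in>C. 0 < c \<and> length ns = c + 1) \<and> (\<forall>m\<in>set ns. 0 < m) \<and> sum_list ns = n}"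

lemma cuts_less:
  assumes "ns \<in> cuts C n" "m \<in> set ns"
  shows "m < n"
proof -
  obtain xs ys where ns: "ns = xs @ m # ys"
    using assms(2) by (meson split_list)
  have "xs @ ys \<noteq> []"
    using assms(1) ns by (auto simp: cuts_def)
  then obtain k where "k \<in> set (xs @ ys)"
    using hd_in_set by blast
  moreover have "0 < k"
    using assms(1) ns \<open>k \<in> set (xs @ ys)\<close> by (auto simp: cuts_def)
  ultimately have "0 < sum_list (xs @ ys)"
    using member_le_sum_list[of k "xs @ ys"] by linarith
  then show ?thesis
    using assms(1) ns by (auto simp: cuts_def)
qed

function grundy :: "nat set \<Rightarrow> nat \<Rightarrow> nat" where
  "grundy C n = mex ((\<lambda>ns. nim_sum (map (grundy C) ns)) ` cuts C n)"
  by auto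
termination
  by (relation "measure snd") (auto dest: cuts_less)

declare grundy.simps [simp del]

lemma grundy_rec:
  assumes "C \<subseteq> {1..}"
  shows "grundy C n =
    mex {nim_sum (map (grundy C) ns) | c ns.
           c \<in> C \<and> length ns = c + 1 \<and> (\<forall>m\<in>set ns. 1 \<le> m) \<and> sum_list ns = n}"
proof -
  have "(\<lambda>ns. nim_sum (map (grundy C) ns)) ` cuts C n =
    {nim_sum (map (grundy C) ns) | c ns.
       c \<in> C \<and> length ns = c + 1 \<and> (\<forall>m\<in>set ns. 1 \<le> m) \<and> sum_list ns = n}"
    using assms unfolding cuts_def by (fastforce simp: Suc_le_eq)
  then show ?thesis
    by (subst grundy.simps) simp
qed

end

theory Submission
  imports Defs
begin

text \<open>
  Write \<open>[P]\<close> for \<open>1\<close> or \<open>0\<close> according to whether \<open>P\<close> holds; the claim is that a heap of size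
  \<open>m\<close> has value \<open>[even m]\<close>. If this is known for smaller heaps, the value of a cut of \<open>n\<close> is the
  parity of its number of even parts. That number is the number of all parts minus the number of
  odd ones; the latter has the parity of the total \<open>n\<close>, and the former, \<open>c + 1\<close>, is even because
  \<open>c\<close> is odd. Hence every option of \<open>n\<close> has value \<open>[odd n]\<close>, whatever the cut
  (lemma \<open>nim_sum_even_indicators\<close>). For odd \<open>n\<close> all options therefore have value \<open>1\<close> (or there
  are none), so the mex is \<open>0\<close>. For even \<open>n\<close> all options have value \<open>0\<close>, and an option exists
  since one may split off a heap of size \<open>1\<close> with a single cut, so the mex is \<open>1\<close>.
\<close>

lemma mex_eq_0: "0 \<notin> U \<Longrightarrow> mex U = 0"
  unfolding mex_def by (rule Least_equality) auto

lemma mex_singleton_0: "mex {0} = 1"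
  unfolding mex_def by (rule Least_equality) auto

text \<open>
  Nim-sum of bits is addition modulo \<open>2\<close>, and \<open>[even m]\<close> is congruent to \<open>1 + m\<close>; adding up over
  the list turns the ones into its length.
\<close>

lemma nim_sum_even_indicators:
  "nim_sum (map (\<lambda>m. of_bool (even m)) ms) = of_bool (odd (length ms + sum_list ms))"
proof (induction ms)
  case Nil
  show ?case by (simp add: nim_sum_def)
next
  case (Cons m ms)
  have "nim_sum (map (\<lambda>m. of_bool (even m)) (m # ms)) =
      xor (of_bool (even m)) (of_bool (odd (length ms + sum_list ms)))"
    using Cons.IH by (simp add: nim_sum_def)
  then show ?case
    by (cases "even m"; cases "even (length ms + sum_list ms)") auto
qed

lemma grundy_odd_cuts:
  assumes odd_C: "\<forall>c\<in>C. odd c" and one: "1 \<in> C" and "n \<ge> 1"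
  shows "grundy C n = of_bool (even n)"
  using \<open>n \<ge> 1\<close>
proof (induction n rule: less_induct)
  case (less n)
  let ?opts = "(\<lambda>ns. nim_sum (map (grundy C) ns)) ` cuts C n"
  have opt: "nim_sum (map (grundy C) ns) = of_bool (odd n)" if "ns \<in> cuts C n" for ns
  proof -
    have "map (grundy C) ns = map (\<lambda>m. of_bool (even m)) ns"
      using less.IH cuts_less[OF that] that by (auto simp: cuts_def Suc_le_eq)
    moreover have "even (length ns)" and "sum_list ns = n"
      using that odd_C by (auto simp: cuts_def)
    ultimately show ?thesis
      using nim_sum_even_indicators[of ns] by (simp only: odd_add) simp
  qed
  have "mex ?opts = of_bool (even n)"
  proof (cases "even n")
    case True
    then have "[1, n - 1] \<in> cuts C n"
      using one less.prems by (auto simp: cuts_def intro!: bexI[of _ 1] elim!: evenE)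
    then have "?opts = {0}"
      using opt True by force
    then show ?thesis
      using True by (simp add: mex_singleton_0)
  next
    case False
    then have "0 \<notin> ?opts"
      using opt by force
    then show ?thesis
      using False by (simp add: mex_eq_0)
  qed
  then show ?case
    by (subst grundy.simps)
qed

theorem proposition3:
  fixes C :: "nat set" and n :: nat
  assumes "C \<subseteq> {1..}"
    and "\<forall>c\<in>C. odd c"
    and "C \<noteq> {}" and "(LEAST c. c \<in> C) = 1"
    and "n \<ge> 1"
  shows "(odd n \<longrightarrow> grundy C n = 0) \<and> (even n \<longrightarrow> grundy C n = 1)"
proof -
  have "1 \<in> C"
    using assms(3,4) LeastI_ex[of "\<lambda>c. c \<in> C"] by auto
  then show ?thesis
    using grundy_odd_cuts[of C n] assms(2,5) by simp
qed

end
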